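(* Let $(G,c)$ be a resistance network with vertex set $V$ and reference vertex $o\in V$. Then $\{v_x\}_{x\in V}$ is a reproducing kernel for $\mathcal H_{\mathcal E}$. Thus $\mathrm{span}\{v_x\}_{x\in V}$ is dense in $\mathcal H_{\mathcal E}$.
   Context: A resistance network $(G,c)$ is a connected graph with vertex set $V$ and a conductance function $c_{xy}=c_{yx}\in[0,\infty)$ with $c_{xx}=0$, where $x\sim y$ (adjacency) iff $c_{xy}>0$, and $c(x):=\sum_{y\sim x}c_{xy}<\infty$ for every $x\in V$. The energy form is $\mathcal E(u,v)=\frac12\sum_{x,y\in V}c_{xy}\overline{(u(x)-u(y))}(v(x)-v(y))$, and $\mathrm{dom}\,\mathcal E=\{u:V\to\mathbb C:\mathcal E(u,u)<\infty\}$. The energy Hilbert space $\mathcal H_{\mathcal E}$ is $\mathrm{dom}\,\mathcal E$ modulo constant functions, with inner product $\langle u,v\rangle_{\mathcal E}=\mathcal E(u,v)$. For $x\in V$, $v_x\in\mathcal H_{\mathcal E}$ is the unique element with $\langle v_x,u\rangle_{\mathcal E}=u(x)-u(o)$ for all $u\in\mathcal H_{\mathcal E}$; it exists by the Riesz lemma because $u\mapsto u(x)-u(o)$ is bounded on $\mathcal H_{\mathcal E}$. "Reproducing kernel" is understood relative to $o$: each element of $\mathcal H_{\mathcal E}$ is identified with its representative vanishing at $o$, and with this identification $\mathcal H_{\mathcal E}$ is a reproducing kernel Hilbert space of functions on $V$ with kernel $(x,y)\mapsto\langle v_x,v_y\rangle_{\mathcal E}=v_x(y)=\overline{v_y(x)}$.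 *)

theory Defs
  imports "HOL-Analysis.Analysis" "HOL-Algebra.Module"
begin

section \<open>Complex Hilbert spaces on a carrier set\<close>

definition complex_ring :: "complex ring" where
  "complex_ring = \<lparr>carrier = UNIV, mult = (*), one = 1, zero = 0, add = (+)\<rparr>"

record 'h inner_module = "(complex, 'h) module" +
  cinner :: "'h \<Rightarrow> 'h \<Rightarrow> complex"

definition hnorm :: "('h, 'm) inner_module_scheme \<Rightarrow> 'h \<Rightarrow> real" where
  "hnorm H f = sqrt (Re (cinner H f f))"

text \<open>The library locale \<^locale>\<open>Metric_space\<close> asks for symmetry and nonnegativity of the
  distance on the whole type, hence the value 0 outside the carrier.\<close>

definition hdist :: "('h, 'm) inner_module_scheme \<Rightarrow> 'h \<Rightarrow> 'h \<Rightarrow> real" where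
  "hdist H f g =
    (if f \<in> carrier H \<and> g \<in> carrier H then hnorm H (f \<ominus>\<^bsub>H\<^esub> g) else 0)"

abbreviation htopology :: "('h, 'm) inner_module_scheme \<Rightarrow> 'h topology" where
  "htopology H \<equiv> Metric_space.mtopology (carrier H) (hdist H)"

text \<open>The inner product is linear in the second argument and conjugate linear in the first.\<close>

locale complex_hilbert_space = Module.module complex_ring H
  for H :: "('h, 'm) inner_module_scheme" (structure) +
  assumes cinner_add_right: "\<lbrakk>f \<in> carrier H; g \<in> carrier H; h \<in> carrier H\<rbrakk> \<Longrightarrow>
      cinner H f (g \<oplus> h) = cinner H f g + cinner H f h"
    and cinner_smult_right: "\<lbrakk>f \<in> carrier H; g \<in> carrier H\<rbrakk> \<Longrightarrow>
      cinner H f (a \<odot> g) = a * cinner H f g"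
    and cinner_commute: "\<lbrakk>f \<in> carrier H; g \<in> carrier H\<rbrakk> \<Longrightarrow>
      cinner H g f = cnj (cinner H f g)"
    and cinner_nonneg: "f \<in> carrier H \<Longrightarrow> 0 \<le> Re (cinner H f f)"
    and cinner_definite: "\<lbrakk>f \<in> carrier H; cinner H f f = 0\<rbrakk> \<Longrightarrow> f = \<zero>"
    and complete: "Metric_space.mcomplete (carrier H) (hdist H)"

definition hspan :: "('h, 'm) inner_module_scheme \<Rightarrow> 'h set \<Rightarrow> 'h set" where
  "hspan H S = (\<lambda>N. submodule N complex_ring H) hull S"

section \<open>Reproducing kernel Hilbert spaces\<close>

text \<open>\<open>ev\<close> identifies the elements of the Hilbert space with functions on \<open>'v\<close>.\<close>

locale rkhs = complex_hilbert_space H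
  for H :: "('h, 'm) inner_module_scheme" (structure) +
  fixes ev :: "'h \<Rightarrow> 'v \<Rightarrow> complex"
  assumes ev_inj: "inj_on ev (carrier H)"
    and ev_add: "\<lbrakk>f \<in> carrier H; g \<in> carrier H\<rbrakk> \<Longrightarrow> ev (f \<oplus> g) x = ev f x + ev g x"
    and ev_smult: "f \<in> carrier H \<Longrightarrow> ev (a \<odot> f) x = a * ev f x"
    and ev_bounded: "\<exists>B. \<forall>f\<in>carrier H. cmod (ev f x) \<le> B * hnorm H f"

definition reproducing_kernel ::
  "('h, 'm) inner_module_scheme \<Rightarrow> ('h \<Rightarrow> 'v \<Rightarrow> complex) \<Rightarrow> ('v \<Rightarrow> 'h) \<Rightarrow> bool" where
  "reproducing_kernel H ev k \<longleftrightarrow>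
    rkhs H ev \<and> range k \<subseteq> carrier H \<and> (\<forall>x. \<forall>f\<in>carrier H. cinner H (k x) f = ev f x)"

section \<open>Resistance networks and their energy space\<close>

text \<open>The vertex set is the type \<open>'v\<close>.\<close>

locale resistance_network =
  fixes c :: "'v \<Rightarrow> 'v \<Rightarrow> real"
  assumes symmetric: "c x y = c y x"
    and nonneg: "0 \<le> c x y"
    and no_loops: "c x x = 0"
    and total_finite: "(\<lambda>y. c x y) summable_on {y. c x y > 0}"
    and connected: "(\<lambda>x y. c x y > 0)\<^sup>*\<^sup>* x y"

definition energy_summand ::
  "('v \<Rightarrow> 'v \<Rightarrow> real) \<Rightarrow> ('v \<Rightarrow> complex) \<Rightarrow> ('v \<Rightarrow> complex) \<Rightarrow> 'v \<times> 'v \<Rightarrow> complex" where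
  "energy_summand c u v = (\<lambda>(x, y). of_real (c x y) * cnj (u x - u y) * (v x - v y))"

definition energy ::
  "('v \<Rightarrow> 'v \<Rightarrow> real) \<Rightarrow> ('v \<Rightarrow> complex) \<Rightarrow> ('v \<Rightarrow> complex) \<Rightarrow> complex" where
  "energy c u v = 1/2 * (\<Sum>\<^sub>\<infinity>p\<in>UNIV. energy_summand c u v p)"

text \<open>The terms of the sum for \<open>energy c u u\<close> are nonnegative reals, so finiteness of the energy
  is summability; \<^const>\<open>infsum\<close> would return 0 for a divergent sum.\<close>

definition dom_energy :: "('v \<Rightarrow> 'v \<Rightarrow> real) \<Rightarrow> ('v \<Rightarrow> complex) set" where
  "dom_energy c = {u. energy_summand c u u summable_on UNIV}"

definition const_rel ::
  "('v \<Rightarrow> 'v \<Rightarrow> real) \<Rightarrow> (('v \<Rightarrow> complex) \<times> ('v \<Rightarrow> complex)) set" where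
  "const_rel c = {(u, w). u \<in> dom_energy c \<and> w \<in> dom_energy c \<and> (\<exists>k. \<forall>x. u x = w x + k)}"

lemma equiv_const_rel: "equiv (dom_energy c) (const_rel c)"
proof (rule equivI)
  show "const_rel c \<subseteq> dom_energy c \<times> dom_energy c"
    unfolding const_rel_def by blast
  have "\<exists>k. \<forall>x. u x = u x + k" for u :: "'a \<Rightarrow> complex"
    by (rule exI[of _ 0]) simp
  then show "refl_on (dom_energy c) (const_rel c)"
    unfolding refl_on_def const_rel_def by blast
  have "\<exists>k. \<forall>x. w x = u x + k" if "\<forall>x. u x = w x + k" for u w :: "'a \<Rightarrow> complex" and k
    by (rule exI[of _ "- k"]) (simp add: that)
  then show "sym (const_rel c)"
    unfolding sym_def const_rel_def by blast
  have "\<exists>k. \<forall>x. u x = w x + k" if "\<forall>x. u x = v x + k" "\<forall>x. v x = w x + l"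
    for u v w :: "'a \<Rightarrow> complex" and k l
    by (rule exI[of _ "l + k"]) (simp add: that)
  then show "trans (const_rel c)"
    unfolding trans_def const_rel_def by blast
qed

lemma energy_const_rel:
  assumes "(u, u') \<in> const_rel c" "(w, w') \<in> const_rel c"
  shows "energy c u w = energy c u' w'"
proof -
  obtain k l where "\<forall>x. u x = u' x + k" "\<forall>x. w x = w' x + l"
    using assms unfolding const_rel_def by blast
  then show ?thesis
    by (simp add: energy_def energy_summand_def)
qed

text \<open>The elements of the energy space are the classes of finite energy functions modulo
  constants. Its operations are those of representatives; the module record inherits a ring
  multiplication and unit, which play no role in \<^locale>\<open>Module.module\<close>.\<close>

definition energy_space :: "('v \<Rightarrow> 'v \<Rightarrow> real) \<Rightarrow> ('v \<Rightarrow> complex) set inner_module" where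
  "energy_space c =
    \<lparr>carrier = dom_energy c // const_rel c,
     mult = (\<lambda>_ _. undefined),
     one = undefined,
     zero = const_rel c `` {\<lambda>_. 0},
     add = (\<lambda>U W. \<Union>u\<in>U. \<Union>w\<in>W. const_rel c `` {\<lambda>x. u x + w x}),
     smult = (\<lambda>a U. \<Union>u\<in>U. const_rel c `` {\<lambda>x. a * u x}),
     cinner = (\<lambda>U W. THE z. \<forall>u\<in>U. \<forall>w\<in>W. z = energy c u w)\<rparr>"

lemma cinner_energy_space:
  assumes "u \<in> dom_energy c" "w \<in> dom_energy c"
  shows "cinner (energy_space c) (const_rel c `` {u}) (const_rel c `` {w}) = energy c u w"
proof -
  have "u \<in> const_rel c `` {u}" "w \<in> const_rel c `` {w}"
    using equiv_class_self[OF equiv_const_rel] assms by blast+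
  moreover have "energy c u w = energy c u' w'"
    if "u' \<in> const_rel c `` {u}" "w' \<in> const_rel c `` {w}" for u' w'
    using energy_const_rel[of u u' c w w'] that by blast
  ultimately have "(THE z. \<forall>u'\<in>const_rel c `` {u}. \<forall>w'\<in>const_rel c `` {w}. z = energy c u' w')
      = energy c u w"
    by (intro the_equality) blast+
  then show ?thesis
    by (simp add: energy_space_def)
qed

definition dipole :: "('v \<Rightarrow> 'v \<Rightarrow> real) \<Rightarrow> 'v \<Rightarrow> 'v \<Rightarrow> ('v \<Rightarrow> complex) set" where
  "dipole c ref x = (THE V. V \<in> carrier (energy_space c) \<and>
     (\<forall>U\<in>carrier (energy_space c). \<forall>u\<in>U. cinner (energy_space c) V U = u x - u ref))"

definition normalized_rep :: "'v \<Rightarrow> ('v \<Rightarrow> complex) set \<Rightarrow> 'v \<Rightarrow> complex" where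
  "normalized_rep ref U = (THE u. u \<in> U \<and> u ref = 0)"

end

theory Submission
  imports Defs
begin

text \<open>Along a path from \<open>ref\<close> to \<open>x\<close> each increment of \<open>u\<close> is controlled by the energy of \<open>u\<close> on
  one edge, so evaluation is bounded. The same bound makes Cauchy sequences converge pointwise,
  whence completeness, and the Riesz lemma yields the dipoles. An element orthogonal to all dipoles
  is constant, hence zero; and in a Hilbert space a total set has dense span.\<close>

text \<open>The Riesz lemma is proved in a form that serves twice. A bounded functional given on a
  submodule \<open>N\<close>, closed or not, is represented on \<open>N\<close> by an element of the
  closure of \<open>N\<close>. With \<open>N\<close> the whole carrier this yields the dipoles. With
  \<open>N\<close> the span of the dipoles it replaces the orthogonal projection onto the closed
  span, so neither completeness of that closure nor an extension of the functional to it has to be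
  established. A second point is the orientation of the kernel. The reproducing property gives the
  inner product of \<open>v x\<close> and \<open>v y\<close> as the value of \<open>v y\<close> at
  \<open>x\<close>, whereas the claim has the value of \<open>v x\<close> at \<open>y\<close>.
  Hermitian symmetry only says that these are conjugate, so it must also be shown that the
  normalized dipoles are real-valued.\<close>

lemma complex_ring_simps [simp]:
  "carrier complex_ring = UNIV" "mult complex_ring = (*)" "one complex_ring = 1"
  "zero complex_ring = 0" "add complex_ring = (+)"
  by (simp_all add: complex_ring_def)

lemma cring_complex_ring: "cring complex_ring"
proof (intro cringI abelian_groupI comm_monoidI)
  show "\<exists>y\<in>carrier complex_ring. y \<oplus>\<^bsub>complex_ring\<^esub> x = \<zero>\<^bsub>complex_ring\<^esub>" for x
    by (rule bexI[of _ "- x"]) simp_all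
qed (simp_all add: algebra_simps)

lemma a_inv_complex_ring [simp]: "\<ominus>\<^bsub>complex_ring\<^esub> a = - a"
proof -
  interpret cring complex_ring
    by (rule cring_complex_ring)
  show ?thesis
    using minus_equality[of "- a" a] by simp
qed

text \<open>A discriminant bound with complex parameter \<open>a\<close>. It is used with
  \<open>\<delta>\<close> a squared norm for Cauchy-Schwarz, and with \<open>\<delta>\<close> the
  excess of a near-minimiser over the infimum for the first variation in the Riesz lemma.\<close>

lemma quadratic_nonneg_imp_bound:
  fixes z :: complex and b \<delta> :: real
  assumes "\<And>a. 0 \<le> \<delta> + 2 * Re (a * z) + (cmod a)\<^sup>2 * b\<^sup>2"
  shows "(cmod z)\<^sup>2 \<le> \<delta> * b\<^sup>2"
proof -
  have *: "0 \<le> \<delta> - 2 * s * (cmod z)\<^sup>2 + s\<^sup>2 * (cmod z)\<^sup>2 * b\<^sup>2" for s :: real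
  proof -
    \<comment> \<open>Taking \<open>a\<close> to be \<open>- s * cnj z\<close> makes
      \<open>a * z\<close> real and leaves a real quadratic in \<open>s\<close>.\<close>
    have "of_real (- s) * cnj z * z = of_real (- s * (cmod z)\<^sup>2)"
      by (simp only: of_real_mult complex_norm_square mult.assoc mult.commute[of "cnj z"])
    moreover have "(cmod (of_real (- s) * cnj z))\<^sup>2 = s\<^sup>2 * (cmod z)\<^sup>2"
      by (simp add: norm_mult power_mult_distrib)
    ultimately show ?thesis
      using assms[of "of_real (- s) * cnj z"] by (simp only: Re_complex_of_real)
  qed
  show ?thesis
  proof (cases "b = 0")
    case True
    have "z = 0"
    proof (rule ccontr)
      assume "z \<noteq> 0"
      then show False
        \<comment> \<open>For \<open>b = 0\<close> the expression is affine in \<open>s\<close>, and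
          this \<open>s\<close> gives it the value -1.\<close>
        using *[of "(\<delta> + 1) / (2 * (cmod z)\<^sup>2)"] True by simp
    qed
    then show ?thesis
      using True by simp
  next
    case False
    then have "(1 / b\<^sup>2)\<^sup>2 * (cmod z)\<^sup>2 * b\<^sup>2 = (cmod z)\<^sup>2 / b\<^sup>2"
      by (simp add: power2_eq_square)
    \<comment> \<open>The quadratic in \<open>s\<close> is smallest at
      \<open>s = 1 / b^2\<close>.\<close>
    then have "(cmod z)\<^sup>2 / b\<^sup>2 \<le> \<delta>"
      using *[of "1 / b\<^sup>2"] by simp
    then show ?thesis
      using False by (simp add: pos_divide_le_eq)
  qed
qed

section \<open>Complex inner product spaces on a carrier set\<close>

text \<open>The axioms of \<open>complex_hilbert_space\<close> without completeness. The facts about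
  norm and distance must be available for the energy space before its completeness is proved, since
  that proof already works with \<open>hdist\<close> as a metric.\<close>

locale complex_inner_space = Module.module complex_ring H
  for H :: "('h, 'm) inner_module_scheme" (structure) +
  assumes inner_add_right: "\<lbrakk>f \<in> carrier H; g \<in> carrier H; h \<in> carrier H\<rbrakk> \<Longrightarrow>
      cinner H f (g \<oplus> h) = cinner H f g + cinner H f h"
    and inner_smult_right: "\<lbrakk>f \<in> carrier H; g \<in> carrier H\<rbrakk> \<Longrightarrow>
      cinner H f (a \<odot> g) = a * cinner H f g"
    and inner_commute: "\<lbrakk>f \<in> carrier H; g \<in> carrier H\<rbrakk> \<Longrightarrow>
      cinner H g f = cnj (cinner H f g)"
    and inner_nonneg: "f \<in> carrier H \<Longrightarrow> 0 \<le> Re (cinner H f f)"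
    and inner_definite: "\<lbrakk>f \<in> carrier H; cinner H f f = 0\<rbrakk> \<Longrightarrow> f = \<zero>"
begin

lemma smult_mem [simp, intro]: "f \<in> carrier H \<Longrightarrow> a \<odot> f \<in> carrier H"
  using smult_closed by simp

lemma minus_one_smult: "f \<in> carrier H \<Longrightarrow> (- 1) \<odot> f = \<ominus> f"
  using smult_l_minus[of 1 f] smult_one[of f] by simp

lemma diff_eq_smult: "f \<in> carrier H \<Longrightarrow> g \<in> carrier H \<Longrightarrow> f \<ominus> g = f \<oplus> (- 1) \<odot> g"
  by (simp add: minus_one_smult a_minus_def)

lemma diff_mem [simp, intro]: "f \<in> carrier H \<Longrightarrow> g \<in> carrier H \<Longrightarrow> f \<ominus> g \<in> carrier H"
  by (simp add: diff_eq_smult)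

lemma diff_eq_zero_iff [simp]:
  assumes "f \<in> carrier H" "g \<in> carrier H"
  shows "f \<ominus> g = \<zero> \<longleftrightarrow> f = g"
proof
  assume "f \<ominus> g = \<zero>"
  then have "f \<oplus> (\<ominus> g \<oplus> g) = \<zero> \<oplus> g"
    using assms by (simp add: a_minus_def flip: M.a_assoc del: M.l_zero)
  then show "f = g"
    using assms by (simp add: M.l_neg)
qed (use assms in \<open>simp add: a_minus_def M.r_neg\<close>)

lemma inner_add_left:
  assumes "f \<in> carrier H" "g \<in> carrier H" "h \<in> carrier H"
  shows "cinner H (f \<oplus> g) h = cinner H f h + cinner H g h"
  using assms inner_commute[of h "f \<oplus> g"] inner_commute[of h f] inner_commute[of h g]
  by (simp add: inner_add_right)

lemma inner_smult_left:
  assumes "f \<in> carrier H" "g \<in> carrier H"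
  shows "cinner H (a \<odot> f) g = cnj a * cinner H f g"
  using assms inner_commute[of g "a \<odot> f"] inner_commute[of g f]
  by (simp add: inner_smult_right)

lemma inner_diff_left:
  assumes "f \<in> carrier H" "g \<in> carrier H" "h \<in> carrier H"
  shows "cinner H (f \<ominus> g) h = cinner H f h - cinner H g h"
  using assms by (simp add: diff_eq_smult inner_add_left inner_smult_left)

lemma hnorm_nonneg: "f \<in> carrier H \<Longrightarrow> 0 \<le> hnorm H f"
  by (simp add: hnorm_def inner_nonneg)

lemma hnorm_sq: "f \<in> carrier H \<Longrightarrow> (hnorm H f)\<^sup>2 = Re (cinner H f f)"
  by (simp add: hnorm_def inner_nonneg)

text \<open>Hermitian symmetry makes the diagonal real, so the real part taken in
  \<open>hnorm\<close> loses nothing.\<close>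

lemma inner_self: "f \<in> carrier H \<Longrightarrow> cinner H f f = of_real ((hnorm H f)\<^sup>2)"
  using inner_commute[of f f] by (simp add: hnorm_sq complex_eq_iff)

lemma hnorm_eq_0_iff: "f \<in> carrier H \<Longrightarrow> hnorm H f = 0 \<longleftrightarrow> f = \<zero>"
proof
  assume "f \<in> carrier H" "hnorm H f = 0"
  then show "f = \<zero>"
    using inner_definite inner_self by simp
next
  assume "f \<in> carrier H" "f = \<zero>"
  then have "cinner H f f = 0"
    using inner_smult_right[of f f 0] smult_l_null[of f] by simp
  then show "hnorm H f = 0"
    by (simp add: hnorm_def)
qed

lemma hnorm_smult: "f \<in> carrier H \<Longrightarrow> hnorm H (a \<odot> f) = cmod a * hnorm H f"
proof -
  assume f: "f \<in> carrier H"
  have "cinner H (a \<odot> f) (a \<odot> f) = (a * cnj a) * cinner H f f"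
    using f by (simp add: inner_smult_left inner_smult_right)
  also have "\<dots> = of_real ((cmod a)\<^sup>2 * (hnorm H f)\<^sup>2)"
    unfolding inner_self[OF f] complex_norm_square[symmetric] of_real_mult by simp
  finally have "Re (cinner H (a \<odot> f) (a \<odot> f)) = (cmod a)\<^sup>2 * (hnorm H f)\<^sup>2"
    by (simp only: Re_complex_of_real)
  then show ?thesis
    using f hnorm_nonneg[OF f] by (simp add: hnorm_def[of H "a \<odot> f"] real_sqrt_mult)
qed

lemma hnorm_add_sq:
  assumes "f \<in> carrier H" "g \<in> carrier H"
  shows "(hnorm H (f \<oplus> g))\<^sup>2 = (hnorm H f)\<^sup>2 + 2 * Re (cinner H f g) + (hnorm H g)\<^sup>2"
  using assms inner_commute[of f g]
  by (simp add: hnorm_sq inner_add_left inner_add_right)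

text \<open>The right-hand side has the shape of the hypothesis of
  \<open>quadratic_nonneg_imp_bound\<close>.\<close>

lemma hnorm_add_smult_sq:
  assumes "f \<in> carrier H" "g \<in> carrier H"
  shows "(hnorm H (f \<oplus> a \<odot> g))\<^sup>2
    = (hnorm H f)\<^sup>2 + 2 * Re (a * cinner H f g) + (cmod a)\<^sup>2 * (hnorm H g)\<^sup>2"
  using assms by (simp add: hnorm_add_sq inner_smult_right hnorm_smult power_mult_distrib)

lemma cauchy_schwarz:
  assumes "f \<in> carrier H" "g \<in> carrier H"
  shows "cmod (cinner H f g) \<le> hnorm H f * hnorm H g"
proof (rule power2_le_imp_le)
  have "(cmod (cinner H f g))\<^sup>2 \<le> (hnorm H f)\<^sup>2 * (hnorm H g)\<^sup>2"
    by (intro quadratic_nonneg_imp_bound) (simp only: hnorm_add_smult_sq[OF assms, symmetric] zero_le_power2)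
  then show "(cmod (cinner H f g))\<^sup>2 \<le> (hnorm H f * hnorm H g)\<^sup>2"
    by (simp add: power_mult_distrib)
qed (simp add: assms hnorm_nonneg)

lemma hnorm_triangle:
  assumes "f \<in> carrier H" "g \<in> carrier H"
  shows "hnorm H (f \<oplus> g) \<le> hnorm H f + hnorm H g"
proof (rule power2_le_imp_le)
  have "Re (cinner H f g) \<le> hnorm H f * hnorm H g"
    using cauchy_schwarz[OF assms] complex_Re_le_cmod order_trans by blast
  then show "(hnorm H (f \<oplus> g))\<^sup>2 \<le> (hnorm H f + hnorm H g)\<^sup>2"
    by (simp add: hnorm_add_sq[OF assms] power2_sum)
qed (simp add: assms hnorm_nonneg)

lemma Metric_space_hdist: "Metric_space (carrier H) (hdist H)"
proof
  show "0 \<le> hdist H f g" for f g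
    by (simp add: hdist_def hnorm_nonneg)
  show "hdist H f g = hdist H g f" for f g
  proof (cases "f \<in> carrier H \<and> g \<in> carrier H")
    case True
    then have "g \<ominus> f = (- 1) \<odot> (f \<ominus> g)"
      by (simp add: minus_one_smult a_minus_def M.minus_add M.a_comm)
    then show ?thesis
      using True by (simp add: hdist_def hnorm_smult)
  qed (auto simp: hdist_def)
  show "hdist H f g = 0 \<longleftrightarrow> f = g" if "f \<in> carrier H" "g \<in> carrier H" for f g
    using that by (simp add: hdist_def hnorm_eq_0_iff)
  show "hdist H f h \<le> hdist H f g + hdist H g h"
    if "f \<in> carrier H" "g \<in> carrier H" "h \<in> carrier H" for f g h
  proof -
    have "f \<ominus> h = (f \<ominus> g) \<oplus> (g \<ominus> h)"
      using that by (simp add: a_minus_def M.a_assoc M.r_neg1)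
    then show ?thesis
      using that hnorm_triangle[of "f \<ominus> g" "g \<ominus> h"] by (simp add: hdist_def)
  qed
qed

sublocale hdist: Metric_space "carrier H" "hdist H"
  by (rule Metric_space_hdist)

text \<open>The hull is an intersection of submodules. Since \<open>S\<close> lies in the carrier,
  the carrier is one of them, so the family is nonempty and the intersection stays inside the
  carrier.\<close>

lemma submodule_hspan:
  assumes "S \<subseteq> carrier H"
  shows "submodule (hspan H S) complex_ring H"
proof (rule submoduleI)
  show "hspan H S \<subseteq> carrier H"
    unfolding hspan_def using assms carrier_is_submodule by (rule hull_minimal)
  have "\<zero> \<in> N" if "submodule N complex_ring H" for N
    using subgroup.one_closed[OF submodule.axioms(1)[OF that]] by simp
  then show "\<zero> \<in> hspan H S"
    by (simp add: hspan_def hull_def)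
  show "\<ominus> f \<in> hspan H S" if "f \<in> hspan H S" for f
    using that submoduleE(3) by (simp add: hspan_def hull_def)
  show "f \<oplus> g \<in> hspan H S" if "f \<in> hspan H S" "g \<in> hspan H S" for f g
    using that submoduleE(5) by (simp add: hspan_def hull_def)
  show "a \<odot> f \<in> hspan H S" if "a \<in> carrier complex_ring" "f \<in> hspan H S" for a f
    using that submoduleE(4) by (simp add: hspan_def hull_def)
qed

text \<open>By Cauchy-Schwarz the inner product is Lipschitz in its first argument, with constant
  \<open>hnorm H h\<close>.\<close>

lemma limitin_cinner:
  assumes lim: "limitin (htopology H) F f sequentially" and F: "\<And>n. F n \<in> carrier H"
    and h: "h \<in> carrier H"
  shows "(\<lambda>n. cinner H (F n) h) \<longlonglongrightarrow> cinner H f h"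
proof -
  have f: "f \<in> carrier H"
    using lim hdist.limitin_mspace by blast
  have "(\<lambda>n. hdist H (F n) f) \<longlonglongrightarrow> 0"
    using lim unfolding hdist.limitin_metric_dist_null by blast
  then have "(\<lambda>n. hdist H (F n) f * hnorm H h) \<longlonglongrightarrow> 0"
    by (rule tendsto_mult_left_zero)
  moreover have "cmod (cinner H (F n) h - cinner H f h) \<le> hdist H (F n) f * hnorm H h" for n
    using cauchy_schwarz[of "F n \<ominus> f" h] f F h by (simp add: inner_diff_left hdist_def)
  ultimately have "(\<lambda>n. cinner H (F n) h - cinner H f h) \<longlonglongrightarrow> 0"
    by (rule Lim_null_comparison[OF always_eventually, OF allI, rotated])
  then show ?thesis
    by (rule LIM_zero_cancel)
qed

end

section \<open>Riesz representation and density of spans in Hilbert spaces\<close>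

sublocale complex_hilbert_space \<subseteq> complex_inner_space
  by (intro complex_inner_space.intro complex_inner_space_axioms.intro module_axioms
      cinner_add_right cinner_smult_right cinner_commute cinner_nonneg cinner_definite)

context complex_hilbert_space
begin

text \<open>A minimising sequence of \<open>\<parallel>f\<parallel>\<^sup>2 - 2 Re (L f)\<close> over \<open>N\<close> is Cauchy by the parallelogram law,
  and its limit represents \<open>L\<close> by the first variation.\<close>

lemma riesz_closure:
  assumes N: "submodule N complex_ring H"
    and L_add: "\<And>f g. f \<in> N \<Longrightarrow> g \<in> N \<Longrightarrow> L (f \<oplus> g) = L f + L g"
    and L_smult: "\<And>a f. f \<in> N \<Longrightarrow> L (a \<odot> f) = a * L f"
    and L_bound: "\<And>f. f \<in> N \<Longrightarrow> cmod (L f) \<le> B * hnorm H f"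
  shows "\<exists>f\<in>htopology H closure_of N. \<forall>h\<in>N. cinner H f h = L h"
proof -
  \<comment> \<open>If \<open>p\<close> represents \<open>L\<close>, then \<open>J f\<close> is the
    squared distance from \<open>f\<close> to \<open>p\<close> minus the squared norm of
    \<open>p\<close>, so minimising \<open>J\<close> over \<open>N\<close> means approximating
    \<open>p\<close> from \<open>N\<close>.\<close>
  define J where "J f = (hnorm H f)\<^sup>2 - 2 * Re (L f)" for f
  define m where "m = Inf (J ` N)"
  note N_mem [simp] = subsetD[OF submoduleE(1)[OF N]]
  note N_add [simp] = submoduleE(5)[OF N]
  have N_smult [simp]: "a \<odot> f \<in> N" if "f \<in> N" for a f
    using submoduleE(4)[OF N] that by simp
  have "- B\<^sup>2 \<le> J f" if "f \<in> N" for f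
  proof -
    have "Re (L f) \<le> B * hnorm H f"
      using L_bound[OF that] complex_Re_le_cmod order_trans by blast
    moreover have "0 \<le> (hnorm H f - B)\<^sup>2"
      by simp
    ultimately show ?thesis
      unfolding J_def power2_diff by (simp add: algebra_simps)
  qed
  then have bdd: "bdd_below (J ` N)"
    by (intro bdd_belowI2)
  then have m_le: "m \<le> J f" if "f \<in> N" for f
    unfolding m_def using that by (intro cInf_lower) auto
  have "\<exists>f\<in>N. J f < m + 1 / (real n + 1)" for n
    using cInf_lessD[of "J ` N" "m + 1 / (real n + 1)"] submoduleE(2)[OF N]
    unfolding m_def by auto
  then obtain F where F: "\<And>n. F n \<in> N" "\<And>n. J (F n) < m + 1 / (real n + 1)"
    by metis
  have F_mem: "F n \<in> carrier H" for n
    using F(1) by simp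
  \<comment> \<open>The linear terms cancel in
    \<open>2 * J f + 2 * J g - 4 * J ((1/2) \<odot> (f \<oplus> g))\<close>, which therefore equals
    the squared norm of \<open>f \<ominus> g\<close>. The midpoint lies in \<open>N\<close>, so its
    \<open>J\<close> is at least \<open>m\<close>.\<close>
  have J_diff: "(hnorm H (f \<ominus> g))\<^sup>2 \<le> 2 * (J f - m) + 2 * (J g - m)" if "f \<in> N" "g \<in> N" for f g
  proof -
    have "(hnorm H (f \<ominus> g))\<^sup>2 = (hnorm H f)\<^sup>2 - 2 * Re (cinner H f g) + (hnorm H g)\<^sup>2"
      using that by (simp add: diff_eq_smult hnorm_add_smult_sq)
    moreover define j where "j = J ((1/2) \<odot> (f \<oplus> g))"
    moreover have "4 * j
        = (hnorm H f)\<^sup>2 + 2 * Re (cinner H f g) + (hnorm H g)\<^sup>2 - 4 * Re (L f) - 4 * Re (L g)"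
      using that by (simp add: j_def J_def hnorm_smult L_smult L_add power_divide hnorm_add_sq
          add_divide_distrib)
    moreover have "m \<le> j"
      using that unfolding j_def by (intro m_le) simp
    ultimately show ?thesis
      unfolding J_def[of f] J_def[of g] by argo
  qed
  have "hdist.MCauchy F"
    unfolding hdist.MCauchy_def
  proof (intro conjI allI impI)
    show "range F \<subseteq> carrier H"
      using F_mem by blast
    fix e :: real
    assume "e > 0"
    \<comment> \<open>Beyond \<open>K\<close> both excesses are below \<open>1 / (K + 1)\<close>,
      and \<open>J_diff\<close> weights each of them by 2.\<close>
    then obtain K where K: "4 / (real K + 1) < e\<^sup>2"
      using reals_Archimedean[of "e\<^sup>2 / 4"] by (auto simp: field_simps)
    have "hdist H (F n) (F k) < e" if "K \<le> n" "K \<le> k" for n k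
    proof -
      have "1 / (real n + 1) \<le> 1 / (real K + 1)" "1 / (real k + 1) \<le> 1 / (real K + 1)"
        using that by (simp_all add: frac_le)
      then have "(hnorm H (F n \<ominus> F k))\<^sup>2 < e\<^sup>2"
        using J_diff[OF F(1) F(1), of n k] F(2)[of n] F(2)[of k] K by simp
      then show ?thesis
        using F_mem \<open>e > 0\<close> by (simp add: hdist_def power2_less_imp_less)
    qed
    then show "\<exists>K. \<forall>n k. K \<le> n \<longrightarrow> K \<le> k \<longrightarrow> hdist H (F n) (F k) < e"
      by blast
  qed
  then obtain f where lim: "limitin (htopology H) F f sequentially"
    using complete unfolding hdist.mcomplete_def by blast
  have "cinner H f h = L h" if h: "h \<in> N" for h
  proof -
    \<comment> \<open>The variation is carried out at \<open>F n\<close> rather than at the limit,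
      which may lie outside \<open>N\<close>, where nothing is assumed about \<open>L\<close>. As
      \<open>F n\<close> is only a near-minimiser, the equation
      \<open>cinner H (F n) h = L h\<close> holds up to an error that tends to 0.\<close>
    have bound: "cmod (cinner H (F n) h - L h) \<le> sqrt (1 / (real n + 1) * (hnorm H h)\<^sup>2)" for n
    proof (rule real_le_rsqrt, rule quadratic_nonneg_imp_bound)
      fix a
      have "J (F n \<oplus> a \<odot> h)
          = J (F n) + 2 * Re (a * (cinner H (F n) h - L h)) + (cmod a)\<^sup>2 * (hnorm H h)\<^sup>2"
        using F(1) h by (simp add: J_def hnorm_add_smult_sq L_add L_smult algebra_simps)
      moreover have "m \<le> J (F n \<oplus> a \<odot> h)"
        using F(1) h by (intro m_le) simp
      ultimately show "0 \<le> 1 / (real n + 1) + 2 * Re (a * (cinner H (F n) h - L h))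
          + (cmod a)\<^sup>2 * (hnorm H h)\<^sup>2"
        using F(2)[of n] by linarith
    qed
    have "(\<lambda>n. 1 / (real n + 1)) \<longlonglongrightarrow> 0"
      using LIMSEQ_inverse_real_of_nat by (simp add: inverse_eq_divide add.commute)
    then have "(\<lambda>n. sqrt (1 / (real n + 1) * (hnorm H h)\<^sup>2)) \<longlonglongrightarrow> sqrt (0 * (hnorm H h)\<^sup>2)"
      by (intro tendsto_real_sqrt tendsto_mult_right)
    then have "(\<lambda>n. sqrt (1 / (real n + 1) * (hnorm H h)\<^sup>2)) \<longlonglongrightarrow> 0"
      by simp
    with always_eventually[OF allI, OF bound] have "(\<lambda>n. cinner H (F n) h - L h) \<longlonglongrightarrow> 0"
      by (rule Lim_null_comparison)
    then have "(\<lambda>n. cinner H (F n) h) \<longlonglongrightarrow> L h"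
      by (rule LIM_zero_cancel)
    then show ?thesis
      by (rule LIMSEQ_unique[OF limitin_cinner[OF lim F_mem N_mem[OF h]]])
  qed
  moreover have "f \<in> htopology H closure_of N"
    unfolding hdist.closure_of_sequentially
    by (intro CollectI conjI exI[of _ F] hdist.limitin_mspace[OF lim] lim) (use F(1) F_mem in auto)
  ultimately show ?thesis
    by blast
qed

text \<open>For uniqueness, the difference of two representing elements is orthogonal to
  itself.\<close>

corollary riesz:
  assumes "\<And>f g. f \<in> carrier H \<Longrightarrow> g \<in> carrier H \<Longrightarrow> L (f \<oplus> g) = L f + L g"
    and "\<And>a f. f \<in> carrier H \<Longrightarrow> L (a \<odot> f) = a * L f"
    and "\<And>f. f \<in> carrier H \<Longrightarrow> cmod (L f) \<le> B * hnorm H f"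
  shows "\<exists>!f. f \<in> carrier H \<and> (\<forall>h\<in>carrier H. cinner H f h = L h)"
proof -
  have "\<exists>f\<in>htopology H closure_of carrier H. \<forall>h\<in>carrier H. cinner H f h = L h"
    using assms by (intro riesz_closure[where B = B] carrier_is_submodule)
  then obtain f where f: "f \<in> carrier H" "\<And>h. h \<in> carrier H \<Longrightarrow> cinner H f h = L h"
    using closure_of_subset_topspace[of "htopology H"] by auto
  have "g = f" if "g \<in> carrier H" "\<forall>h\<in>carrier H. cinner H g h = L h" for g
  proof -
    have "cinner H (g \<ominus> f) (g \<ominus> f) = 0"
      using that f by (simp add: inner_diff_left)
    then have "g \<ominus> f = \<zero>"
      using that f by (intro inner_definite) simp_all
    then show ?thesis
      using that f by simp
  qed
  then show ?thesis
    using f by blast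
qed

text \<open>The functional \<open>cinner H f\<close> on the span is represented by an element \<open>p\<close> of the closure,
  and \<open>f \<ominus> p\<close> is orthogonal to \<open>S\<close>.\<close>

lemma closure_hspan:
  assumes S: "S \<subseteq> carrier H"
    and total: "\<And>f. f \<in> carrier H \<Longrightarrow> \<forall>s\<in>S. cinner H f s = 0 \<Longrightarrow> f = \<zero>"
  shows "htopology H closure_of hspan H S = carrier H"
proof
  show "htopology H closure_of hspan H S \<subseteq> carrier H"
    using closure_of_subset_topspace[of "htopology H"] by simp
  show "carrier H \<subseteq> htopology H closure_of hspan H S"
  proof
    fix f
    assume f: "f \<in> carrier H"
    note N = submodule_hspan[OF S]
    note mem [simp] = subsetD[OF submoduleE(1)[OF N]]
    have "\<exists>p\<in>htopology H closure_of hspan H S. \<forall>h\<in>hspan H S. cinner H p h = cinner H f h"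
      using f by (intro riesz_closure[OF N, where B = "hnorm H f"])
        (simp_all add: inner_add_right inner_smult_right cauchy_schwarz)
    then obtain p where p: "p \<in> htopology H closure_of hspan H S"
      "\<And>h. h \<in> hspan H S \<Longrightarrow> cinner H p h = cinner H f h"
      by blast
    then have p_mem: "p \<in> carrier H"
      using closure_of_subset_topspace[of "htopology H"] by auto
    have "S \<subseteq> hspan H S"
      unfolding hspan_def by (rule hull_subset)
    then have "\<forall>s\<in>S. cinner H (f \<ominus> p) s = 0"
      using f p p_mem S by (auto simp: inner_diff_left subset_iff)
    then have "f \<ominus> p = \<zero>"
      using f p_mem by (intro total) simp_all
    then show "f \<in> htopology H closure_of hspan H S"
      using f p p_mem by simp
  qed
qed

end

section \<open>The energy form\<close>

text \<open>The diagonal of \<open>energy_summand\<close> as a real function, so that order and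
  monotonicity arguments apply. Pairs are ordered, hence every edge is counted twice.\<close>

definition edge_energy :: "('v \<Rightarrow> 'v \<Rightarrow> real) \<Rightarrow> ('v \<Rightarrow> complex) \<Rightarrow> 'v \<times> 'v \<Rightarrow> real" where
  "edge_energy c u = (\<lambda>(x, y). c x y * (cmod (u x - u y))\<^sup>2)"

lemma energy_summand_self: "energy_summand c u u p = of_real (edge_energy c u p)"
proof (cases p)
  case (Pair x y)
  then show ?thesis
    by (simp only: energy_summand_def edge_energy_def split of_real_mult complex_norm_square
        mult.assoc mult.commute[of "cnj (u x - u y)"])
qed

lemma energy_summand_cnj:
  "energy_summand c w u p = cnj (energy_summand c u w p)"
  "energy_summand c (\<lambda>x. cnj (u x)) w p = cnj (energy_summand c u (\<lambda>x. cnj (w x)) p)"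
  by (cases p; simp add: energy_summand_def)+

lemma energy_summand_add_right:
  "energy_summand c u (\<lambda>x. w x + z x) p = energy_summand c u w p + energy_summand c u z p"
  by (cases p) (simp add: energy_summand_def algebra_simps)

lemma energy_summand_smult_right:
  "energy_summand c u (\<lambda>x. a * w x) p = a * energy_summand c u w p"
  by (cases p) (simp add: energy_summand_def algebra_simps)

context resistance_network
begin

lemma edge_energy_nonneg: "0 \<le> edge_energy c u p"
  by (cases p) (simp add: edge_energy_def nonneg)

lemma dom_energy_iff: "u \<in> dom_energy c \<longleftrightarrow> edge_energy c u summable_on UNIV"
proof -
  have "cmod (energy_summand c u u p) = edge_energy c u p" for p
    by (simp add: energy_summand_self edge_energy_nonneg)
  then show ?thesis
    unfolding dom_energy_def mem_Collect_eq
    by (subst summable_on_iff_abs_summable_on_complex) simp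
qed

lemma energy_self:
  assumes "u \<in> dom_energy c"
  shows "energy c u u = of_real (infsum (edge_energy c u) UNIV / 2)"
proof -
  have "edge_energy c u summable_on UNIV"
    using assms by (simp add: dom_energy_iff)
  then have "((\<lambda>p. of_real (edge_energy c u p) :: complex)
      has_sum of_real (infsum (edge_energy c u) UNIV)) UNIV"
    by (intro has_sum_of_real has_sum_infsum)
  then have "(\<Sum>\<^sub>\<infinity>p. of_real (edge_energy c u p) :: complex) = of_real (infsum (edge_energy c u) UNIV)"
    by (rule infsumI)
  then show ?thesis
    by (simp add: energy_def energy_summand_self)
qed

text \<open>On each edge the product of two increments is at most the sum of their squares, so the
  mixed summand is dominated by two summable diagonal ones.\<close>

lemma summable_energy_summand:
  assumes "u \<in> dom_energy c" "w \<in> dom_energy c"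
  shows "energy_summand c u w summable_on UNIV"
proof -
  have "cmod (energy_summand c u w p) \<le> edge_energy c u p + edge_energy c w p" for p
  proof (cases p)
    case (Pair x y)
    define a b where "a = cmod (u x - u y)" and "b = cmod (w x - w y)"
    have "a * b \<le> a\<^sup>2 + b\<^sup>2"
    proof -
      have "0 \<le> a * b"
        by (simp add: a_def b_def)
      moreover have "2 * (a * b) \<le> a\<^sup>2 + b\<^sup>2"
        using sum_squares_bound[of a b] by (simp only: mult.assoc)
      ultimately show ?thesis
        by linarith
    qed
    then have "c x y * (a * b) \<le> c x y * (a\<^sup>2 + b\<^sup>2)"
      by (rule mult_left_mono) (rule nonneg)
    then show ?thesis
      using Pair nonneg[of x y]
      by (simp add: energy_summand_def edge_energy_def norm_mult a_def b_def distrib_left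
          mult.assoc del: complex_cnj_diff)
  qed
  moreover have "(\<lambda>p. edge_energy c u p + edge_energy c w p) summable_on UNIV"
    using assms unfolding dom_energy_iff by (rule summable_on_add)
  ultimately have "(\<lambda>p. cmod (energy_summand c u w p)) summable_on UNIV"
    by (intro Infinite_Sum.abs_summable_on_comparison_test')
  then show ?thesis
    by (subst summable_on_iff_abs_summable_on_complex)
qed

lemma dom_energy_const: "(\<lambda>_. k) \<in> dom_energy c"
  by (simp add: dom_energy_def energy_summand_def case_prod_unfold)

lemma dom_energy_smult:
  assumes "u \<in> dom_energy c"
  shows "(\<lambda>x. a * u x) \<in> dom_energy c"
proof -
  have "edge_energy c (\<lambda>x. a * u x) = (\<lambda>p. (cmod a)\<^sup>2 * edge_energy c u p)"
    by (auto simp: edge_energy_def norm_mult power_mult_distrib simp flip: right_diff_distrib)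
  then show ?thesis
    using assms by (simp add: dom_energy_iff summable_on_cmult_right)
qed

lemma dom_energy_cnj: "u \<in> dom_energy c \<Longrightarrow> (\<lambda>x. cnj (u x)) \<in> dom_energy c"
  by (simp add: dom_energy_iff edge_energy_def flip: complex_cnj_diff)

text \<open>The square is expanded; the cross terms are summable by
  \<open>summable_energy_summand\<close>.\<close>

lemma dom_energy_add:
  assumes "u \<in> dom_energy c" "w \<in> dom_energy c"
  shows "(\<lambda>x. u x + w x) \<in> dom_energy c"
proof -
  have "energy_summand c (\<lambda>x. u x + w x) (\<lambda>x. u x + w x)
      = (\<lambda>p. (energy_summand c u u p + energy_summand c u w p)
        + (energy_summand c w u p + energy_summand c w w p))"
    by (auto simp: energy_summand_def algebra_simps)
  then show ?thesis
    unfolding dom_energy_def mem_Collect_eq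
    by (simp only:) (intro summable_on_add summable_energy_summand assms)
qed

lemma dom_energy_diff:
  assumes "u \<in> dom_energy c" "w \<in> dom_energy c"
  shows "(\<lambda>x. u x - w x) \<in> dom_energy c"
  using dom_energy_add[OF assms(1) dom_energy_smult[OF assms(2), of "- 1"]] by simp

lemma energy_add_right:
  assumes "u \<in> dom_energy c" "w \<in> dom_energy c" "z \<in> dom_energy c"
  shows "energy c u (\<lambda>x. w x + z x) = energy c u w + energy c u z"
  using assms by (simp add: energy_def energy_summand_add_right infsum_add summable_energy_summand
      algebra_simps)

lemma energy_smult_right: "energy c u (\<lambda>x. a * w x) = a * energy c u w"
  by (simp add: energy_def energy_summand_smult_right infsum_cmult_right')

lemma energy_commute: "energy c w u = cnj (energy c u w)"
proof -
  have "energy_summand c w u = (\<lambda>p. cnj (energy_summand c u w p))"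
    using energy_summand_cnj(1) by blast
  then show ?thesis
    by (simp add: energy_def)
qed

lemma energy_cnj: "energy c (\<lambda>x. cnj (u x)) w = cnj (energy c u (\<lambda>x. cnj (w x)))"
proof -
  have "energy_summand c (\<lambda>x. cnj (u x)) w = (\<lambda>p. cnj (energy_summand c u (\<lambda>x. cnj (w x)) p))"
    using energy_summand_cnj(2) by blast
  then show ?thesis
    by (simp add: energy_def)
qed

lemma energy_self_nonneg: "u \<in> dom_energy c \<Longrightarrow> 0 \<le> Re (energy c u u)"
  by (simp add: energy_self infsum_nonneg edge_energy_nonneg)

text \<open>The factor 2 undoes the 1/2 in \<open>energy\<close>.\<close>

lemma sum_edge_energy_le:
  assumes "u \<in> dom_energy c" "finite A"
  shows "sum (edge_energy c u) A \<le> 2 * Re (energy c u u)"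
  using assms finite_sum_le_infsum[of "edge_energy c u" UNIV A]
  by (simp add: energy_self dom_energy_iff edge_energy_nonneg)

lemma pointwise_bound:
  "\<exists>B. \<forall>u\<in>dom_energy c. cmod (u x - u y) \<le> B * sqrt (Re (energy c u u))"
  using connected[of y x]
proof (induction rule: rtranclp_induct)
  case base
  show ?case
    by (rule exI[of _ 0]) simp
next
  case (step z x)
  obtain B where B: "\<And>u. u \<in> dom_energy c \<Longrightarrow> cmod (u z - u y) \<le> B * sqrt (Re (energy c u u))"
    using step.IH by blast
  \<comment> \<open>Prolonging the path by the edge from \<open>z\<close> to \<open>x\<close> adds
    the bound for that edge to the constant. Only one orientation of the edge is used, whence
    \<open>2 / c z x\<close>.\<close>
  have "cmod (u x - u y) \<le> (sqrt (2 / c z x) + B) * sqrt (Re (energy c u u))"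
    if u: "u \<in> dom_energy c" for u
  proof -
    have "c z x * (cmod (u x - u z))\<^sup>2 \<le> 2 * Re (energy c u u)"
      using sum_edge_energy_le[OF u, of "{(z, x)}"] by (simp add: edge_energy_def norm_minus_commute)
    then have "(cmod (u x - u z))\<^sup>2 \<le> 2 / c z x * Re (energy c u u)"
      using step.hyps by (simp add: field_simps)
    then have "cmod (u x - u z) \<le> sqrt (2 / c z x * Re (energy c u u))"
      by (rule real_le_rsqrt)
    also have "\<dots> = sqrt (2 / c z x) * sqrt (Re (energy c u u))"
      by (rule real_sqrt_mult)
    finally have "cmod (u x - u z) \<le> sqrt (2 / c z x) * sqrt (Re (energy c u u))" .
    then show ?thesis
      using B[OF u] norm_triangle_ineq[of "u x - u z" "u z - u y"] by (simp add: distrib_right)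
  qed
  then show ?case
    by blast
qed

section \<open>The energy space is a Hilbert space\<close>

abbreviation energy_class :: "('v \<Rightarrow> complex) \<Rightarrow> ('v \<Rightarrow> complex) set" where
  "energy_class u \<equiv> const_rel c `` {u}"

lemma carrier_energy_space: "carrier (energy_space c) = energy_class ` dom_energy c"
  by (auto simp: energy_space_def quotient_def)

lemma energy_class_mem [simp]: "u \<in> dom_energy c \<Longrightarrow> energy_class u \<in> carrier (energy_space c)"
  by (simp add: carrier_energy_space)

lemma energy_class_self: "u \<in> dom_energy c \<Longrightarrow> u \<in> energy_class u"
  using equiv_class_self[OF equiv_const_rel] by blast

lemma energy_class_eq_iff:
  assumes "u \<in> dom_energy c" "w \<in> dom_energy c"
  shows "energy_class u = energy_class w \<longleftrightarrow> (\<exists>k. \<forall>x. u x = w x + k)"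
  unfolding eq_equiv_class_iff[OF equiv_const_rel assms] using assms by (simp add: const_rel_def)

lemma const_rel_iff:
  "(u, w) \<in> const_rel c \<longleftrightarrow> u \<in> dom_energy c \<and> w \<in> dom_energy c \<and> (\<exists>k. \<forall>x. u x = w x + k)"
  by (simp add: const_rel_def)

lemma zero_energy_space: "\<zero>\<^bsub>energy_space c\<^esub> = energy_class (\<lambda>_. 0)"
  by (simp add: energy_space_def)

text \<open>The union over representatives in \<open>energy_space\<close> collapses because every
  pair of representatives gives the same class and there is at least one pair.\<close>

lemma add_energy_class:
  assumes u: "u \<in> dom_energy c" and w: "w \<in> dom_energy c"
  shows "energy_class u \<oplus>\<^bsub>energy_space c\<^esub> energy_class w = energy_class (\<lambda>x. u x + w x)"
proof -
  have eq: "energy_class (\<lambda>x. u' x + w' x) = energy_class (\<lambda>x. u x + w x)"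
    if u': "u' \<in> energy_class u" and w': "w' \<in> energy_class w" for u' w'
  proof -
    obtain k l where "\<And>x. u x = u' x + k" "\<And>x. w x = w' x + l"
      using u' w' by (auto simp: const_rel_iff)
    then have "\<exists>k. \<forall>x. u' x + w' x = u x + w x + k"
      by (intro exI[of _ "- k - l"]) simp
    then show ?thesis
      using u' w' u w by (subst energy_class_eq_iff) (simp_all add: const_rel_iff dom_energy_add)
  qed
  have "energy_class u \<oplus>\<^bsub>energy_space c\<^esub> energy_class w
      = (\<Union>u'\<in>energy_class u. \<Union>w'\<in>energy_class w. energy_class (\<lambda>x. u' x + w' x))"
    by (simp add: energy_space_def)
  also have "\<dots> = (\<Union>u'\<in>energy_class u. \<Union>w'\<in>energy_class w. energy_class (\<lambda>x. u x + w x))"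
    using eq by simp
  also have "\<dots> = energy_class (\<lambda>x. u x + w x)"
    using energy_class_self[OF u] energy_class_self[OF w] by blast
  finally show ?thesis .
qed

lemma smult_energy_class:
  assumes u: "u \<in> dom_energy c"
  shows "a \<odot>\<^bsub>energy_space c\<^esub> energy_class u = energy_class (\<lambda>x. a * u x)"
proof -
  have eq: "energy_class (\<lambda>x. a * u' x) = energy_class (\<lambda>x. a * u x)"
    if u': "u' \<in> energy_class u" for u'
  proof -
    obtain k where "\<And>x. u x = u' x + k"
      using u' by (auto simp: const_rel_iff)
    then have "\<exists>k. \<forall>x. a * u' x = a * u x + k"
      by (intro exI[of _ "- a * k"]) (simp add: algebra_simps)
    then show ?thesis
      using u' u by (subst energy_class_eq_iff) (simp_all add: const_rel_iff dom_energy_smult)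
  qed
  have "a \<odot>\<^bsub>energy_space c\<^esub> energy_class u
      = (\<Union>u'\<in>energy_class u. energy_class (\<lambda>x. a * u' x))"
    by (simp add: energy_space_def)
  also have "\<dots> = (\<Union>u'\<in>energy_class u. energy_class (\<lambda>x. a * u x))"
    using eq by simp
  also have "\<dots> = energy_class (\<lambda>x. a * u x)"
    using energy_class_self[OF u] by blast
  finally show ?thesis .
qed

text \<open>Representatives differ by constants, so the value at \<open>ref\<close> singles one out.
  Allowing an arbitrary \<open>u\<close> in \<open>U\<close> makes the independence of
  representatives part of the statement.\<close>

lemma normalized_rep_eq:
  assumes "U \<in> carrier (energy_space c)" "u \<in> U"
  shows "normalized_rep ref U = (\<lambda>x. u x - u ref)"
  unfolding normalized_rep_def
proof (rule the_equality)
  obtain w where w: "w \<in> dom_energy c" "U = energy_class w"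
    using assms(1) by (auto simp: carrier_energy_space)
  then obtain k where k: "u \<in> dom_energy c" "\<And>x. w x = u x + k"
    using assms(2) by (auto simp: const_rel_iff)
  have "(\<lambda>x. u x - u ref) \<in> dom_energy c"
    using dom_energy_diff[OF k(1) dom_energy_const] .
  then show "(\<lambda>x. u x - u ref) \<in> U \<and> u ref - u ref = 0"
    using w k by (auto simp: const_rel_iff intro: exI[of _ "k + u ref"])
  show "z = (\<lambda>x. u x - u ref)" if z: "z \<in> U \<and> z ref = 0" for z
  proof -
    obtain l where "\<And>x. w x = z x + l"
      using z w by (auto simp: const_rel_iff)
    then have "z x = u x + k - l" for x
      using k by (metis add_diff_cancel)
    then show ?thesis
      using z by (auto simp: fun_eq_iff)
  qed
qed

lemma normalized_rep_class:
  "u \<in> dom_energy c \<Longrightarrow> normalized_rep ref (energy_class u) = (\<lambda>x. u x - u ref)"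
  by (rule normalized_rep_eq[OF energy_class_mem energy_class_self])

lemma module_energy_space: "Module.module complex_ring (energy_space c)"
proof (intro moduleI cring_complex_ring abelian_groupI)
  show "\<exists>W\<in>carrier (energy_space c). W \<oplus>\<^bsub>energy_space c\<^esub> U = \<zero>\<^bsub>energy_space c\<^esub>"
    if U: "U \<in> carrier (energy_space c)" for U
  proof -
    obtain u where u: "u \<in> dom_energy c" "U = energy_class u"
      using U by (auto simp: carrier_energy_space)
    then show ?thesis
      using dom_energy_smult[OF u(1), of "- 1"]
      \<comment> \<open>The negative is written as a multiple by -1 so that
        \<open>dom_energy_smult\<close> supplies its finite energy.\<close>
      by (intro bexI[of _ "energy_class (\<lambda>x. - 1 * u x)"])
        (simp_all add: add_energy_class zero_energy_space)
  qed
qed (auto simp: carrier_energy_space zero_energy_space add_energy_class smult_energy_class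
    dom_energy_add dom_energy_smult dom_energy_const algebra_simps)

lemma complex_inner_space_energy_space: "complex_inner_space (energy_space c)"
proof (intro complex_inner_space.intro complex_inner_space_axioms.intro module_energy_space)
  fix U assume U: "U \<in> carrier (energy_space c)"
  then obtain u where u: "u \<in> dom_energy c" "U = energy_class u"
    by (auto simp: carrier_energy_space)
  then show "0 \<le> Re (cinner (energy_space c) U U)"
    by (simp add: cinner_energy_space energy_self_nonneg)
  show "U = \<zero>\<^bsub>energy_space c\<^esub>" if "cinner (energy_space c) U U = 0"
  proof -
    have 0: "energy c u u = 0"
      using that u by (simp add: cinner_energy_space)
    \<comment> \<open>Any fixed vertex serves as base point here. The right-hand side has the form
      required for equivalence with the zero function.\<close>
    have "u x = 0 + u undefined" for x
      using pointwise_bound[of x undefined] u(1) 0 by auto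
    then show ?thesis
      using u dom_energy_const by (auto simp: zero_energy_space energy_class_eq_iff)
  qed
next
  fix U W assume "U \<in> carrier (energy_space c)" "W \<in> carrier (energy_space c)"
  then obtain u w where "u \<in> dom_energy c" "U = energy_class u"
      "w \<in> dom_energy c" "W = energy_class w"
    by (auto simp: carrier_energy_space)
  then show "cinner (energy_space c) W U = cnj (cinner (energy_space c) U W)"
    and "cinner (energy_space c) U (a \<odot>\<^bsub>energy_space c\<^esub> W) = a * cinner (energy_space c) U W" for a
    by (simp_all add: cinner_energy_space energy_commute[of w u] smult_energy_class
        dom_energy_smult energy_smult_right)
next
  fix U W Z assume "U \<in> carrier (energy_space c)" "W \<in> carrier (energy_space c)"
    "Z \<in> carrier (energy_space c)"
  then obtain u w z where "u \<in> dom_energy c" "U = energy_class u"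
      "w \<in> dom_energy c" "W = energy_class w" "z \<in> dom_energy c" "Z = energy_class z"
    by (auto simp: carrier_energy_space)
  then show "cinner (energy_space c) U (W \<oplus>\<^bsub>energy_space c\<^esub> Z)
      = cinner (energy_space c) U W + cinner (energy_space c) U Z"
    by (simp add: cinner_energy_space add_energy_class dom_energy_add energy_add_right)
qed

interpretation E: complex_inner_space "energy_space c"
  by (rule complex_inner_space_energy_space)

lemma hnorm_energy_class:
  "u \<in> dom_energy c \<Longrightarrow> hnorm (energy_space c) (energy_class u) = sqrt (Re (energy c u u))"
  by (simp add: hnorm_def cinner_energy_space)

lemma hdist_energy_class:
  assumes "u \<in> dom_energy c" "w \<in> dom_energy c"
  shows "hdist (energy_space c) (energy_class u) (energy_class w)
    = sqrt (Re (energy c (\<lambda>x. u x - w x) (\<lambda>x. u x - w x)))"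
proof -
  have "energy_class u \<ominus>\<^bsub>energy_space c\<^esub> energy_class w = energy_class (\<lambda>x. u x - w x)"
    using assms dom_energy_smult[OF assms(2), of "- 1"]
    by (simp add: E.diff_eq_smult smult_energy_class add_energy_class)
  then show ?thesis
    using assms by (simp add: hdist_def hnorm_energy_class dom_energy_diff)
qed

text \<open>Normalised representatives of a Cauchy sequence converge pointwise, and Fatou's lemma on
  finite sets of edges turns this into convergence in energy.\<close>

lemma mcomplete_energy_space:
  "Metric_space.mcomplete (carrier (energy_space c)) (hdist (energy_space c))"
  unfolding E.hdist.mcomplete_def
proof (intro allI impI)
  fix F
  assume Cauchy_F: "E.hdist.MCauchy F"
  define ref :: 'v where "ref = undefined"
  \<comment> \<open>Without a common normalization the constants left free in the classes could keep
    the representatives from converging.\<close>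
  have "\<exists>u. u \<in> dom_energy c \<and> F n = energy_class u \<and> u ref = 0" for n
  proof -
    have "F n \<in> carrier (energy_space c)"
      using Cauchy_F unfolding E.hdist.MCauchy_def by blast
    then obtain u where u: "u \<in> dom_energy c" "F n = energy_class u"
      by (auto simp: carrier_energy_space)
    have "(\<lambda>x. u x - u ref) \<in> dom_energy c"
      using dom_energy_diff[OF u(1) dom_energy_const] .
    moreover from this have "energy_class u = energy_class (\<lambda>x. u x - u ref)"
      using u by (auto simp: energy_class_eq_iff)
    ultimately show ?thesis
      using u by (intro exI[of _ "\<lambda>x. u x - u ref"]) simp
  qed
  then obtain u where u: "\<And>n. u n \<in> dom_energy c" "\<And>n. F n = energy_class (u n)" "\<And>n. u n ref = 0"
    by metis
  define D where "D n k = (\<lambda>x. u n x - u k x)" for n k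
  have D_dom: "D n k \<in> dom_energy c" for n k
    unfolding D_def by (intro dom_energy_diff u)
  have D_small: "\<exists>K. \<forall>n\<ge>K. \<forall>k\<ge>K. sqrt (Re (energy c (D n k) (D n k))) < e" if "e > 0" for e
  proof -
    have "hdist (energy_space c) (F n) (F k) = sqrt (Re (energy c (D n k) (D n k)))" for n k
      using u by (simp add: hdist_energy_class D_def)
    then show ?thesis
      using Cauchy_F that unfolding E.hdist.MCauchy_def by metis
  qed
  have "Cauchy (\<lambda>n. u n x)" for x
  proof (rule CauchyI)
    fix e :: real
    assume e: "e > 0"
    obtain B where B: "\<And>w. w \<in> dom_energy c \<Longrightarrow> cmod (w x - w ref) \<le> B * sqrt (Re (energy c w w))"
      using pointwise_bound by blast
    \<comment> \<open>The sign of \<open>B\<close> is unknown and it may be 0;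
      \<open>\<bar>B\<bar> + 1\<close> is positive and still an upper bound.\<close>
    have "e / (\<bar>B\<bar> + 1) > 0"
      using e by simp
    then obtain K where K: "\<And>n k. K \<le> n \<Longrightarrow> K \<le> k \<Longrightarrow>
        sqrt (Re (energy c (D n k) (D n k))) < e / (\<bar>B\<bar> + 1)"
      using D_small by metis
    have "cmod (u n x - u k x) < e" if "K \<le> n" "K \<le> k" for n k
    proof -
      define r where "r = sqrt (Re (energy c (D n k) (D n k)))"
      have "0 \<le> r"
        unfolding r_def using energy_self_nonneg[OF D_dom] by simp
      then have "B * r \<le> (\<bar>B\<bar> + 1) * r"
        by (intro mult_right_mono) simp_all
      moreover have "cmod (u n x - u k x) \<le> B * r"
        using B[OF D_dom, of n k] u(3) by (simp add: D_def r_def)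
      moreover have "(\<bar>B\<bar> + 1) * r < e"
        using K[OF that] by (simp add: r_def field_simps)
      ultimately show ?thesis
        by linarith
    qed
    then show "\<exists>K. \<forall>n\<ge>K. \<forall>k\<ge>K. cmod (u n x - u k x) < e"
      by blast
  qed
  then have "\<exists>w. \<forall>x. (\<lambda>n. u n x) \<longlonglongrightarrow> w x"
    by (intro choice allI) (simp add: Cauchy_convergent_iff convergent_def)
  then obtain w where w: "\<And>x. (\<lambda>n. u n x) \<longlonglongrightarrow> w x"
    by blast
  have fatou: "\<exists>K. \<forall>n\<ge>K. (\<lambda>x. u n x - w x) \<in> dom_energy c
      \<and> sqrt (Re (energy c (\<lambda>x. u n x - w x) (\<lambda>x. u n x - w x))) \<le> e" if e: "e > 0" for e
  proof -
    obtain K where K: "\<And>n k. K \<le> n \<Longrightarrow> K \<le> k \<Longrightarrow> sqrt (Re (energy c (D n k) (D n k))) < e"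
      using D_small[OF e] by metis
    have "(\<lambda>x. u n x - w x) \<in> dom_energy c
        \<and> sqrt (Re (energy c (\<lambda>x. u n x - w x) (\<lambda>x. u n x - w x))) \<le> e" if n: "K \<le> n" for n
    proof
      \<comment> \<open>The bound is uniform in \<open>A\<close>, so it gives first the finiteness
        of the energy of \<open>u n - w\<close> and then its estimate.\<close>
      have bound: "sum (edge_energy c (\<lambda>x. u n x - w x)) A \<le> 2 * e\<^sup>2" if A: "finite A" for A
      proof (rule LIMSEQ_le_const2)
        have "(\<lambda>k. edge_energy c (D n k) p) \<longlonglongrightarrow> edge_energy c (\<lambda>x. u n x - w x) p" for p
          unfolding D_def edge_energy_def by (cases p) (auto intro!: tendsto_intros w)
        then show "(\<lambda>k. sum (edge_energy c (D n k)) A) \<longlonglongrightarrow> sum (edge_energy c (\<lambda>x. u n x - w x)) A"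
          by (intro tendsto_sum)
        have "sum (edge_energy c (D n k)) A \<le> 2 * e\<^sup>2" if "K \<le> k" for k
          using sum_edge_energy_le[OF D_dom A, of n k] K[OF n that]
            sqrt_le_D[OF less_imp_le] by fastforce
        then show "\<exists>K. \<forall>k\<ge>K. sum (edge_energy c (D n k)) A \<le> 2 * e\<^sup>2"
          by blast
      qed
      then have summable: "edge_energy c (\<lambda>x. u n x - w x) summable_on UNIV"
        by (intro nonneg_bdd_above_summable_on edge_energy_nonneg bdd_aboveI2) auto
      then show dom: "(\<lambda>x. u n x - w x) \<in> dom_energy c"
        by (simp add: dom_energy_iff)
      have "infsum (edge_energy c (\<lambda>x. u n x - w x)) UNIV \<le> 2 * e\<^sup>2"
        using summable bound by (rule infsum_le_finite_sums)
      then show "sqrt (Re (energy c (\<lambda>x. u n x - w x) (\<lambda>x. u n x - w x))) \<le> e"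
        using e dom by (intro real_le_lsqrt) (simp_all add: energy_self)
    qed
    then show ?thesis
      by blast
  qed
  obtain n where "(\<lambda>x. u n x - w x) \<in> dom_energy c"
    using fatou[of 1] by auto
  \<comment> \<open>The limit is \<open>u n - (u n - w)\<close>, a difference of two functions of
    finite energy.\<close>
  from dom_energy_diff[OF u(1)[of n] this] have w_dom: "w \<in> dom_energy c"
    by simp
  have "(\<lambda>n. hdist (energy_space c) (F n) (energy_class w)) \<longlonglongrightarrow> 0"
  proof (rule LIMSEQ_I)
    fix e :: real
    assume "e > 0"
    \<comment> \<open>Passing to the limit leaves only \<open>\<le>\<close> in \<open>fatou\<close>;
      using it at \<open>e / 2\<close> restores the strict inequality.\<close>
    then obtain K where K: "\<And>n. K \<le> n \<Longrightarrow>
        sqrt (Re (energy c (\<lambda>x. u n x - w x) (\<lambda>x. u n x - w x))) \<le> e / 2"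
      using fatou[of "e / 2"] by auto
    then have "norm (hdist (energy_space c) (F n) (energy_class w) - 0) < e" if "K \<le> n" for n
      using K[OF that] \<open>e > 0\<close> energy_self_nonneg[OF dom_energy_diff[OF u(1) w_dom], of n]
      by (simp add: u(2) hdist_energy_class u(1) w_dom)
    then show "\<exists>K. \<forall>n\<ge>K. norm (hdist (energy_space c) (F n) (energy_class w) - 0) < e"
      by blast
  qed
  then have "limitin (htopology (energy_space c)) F (energy_class w) sequentially"
    using u w_dom by (simp add: E.hdist.limitin_metric_dist_null)
  then show "\<exists>f. limitin (htopology (energy_space c)) F f sequentially"
    by blast
qed

lemma complex_hilbert_space_energy_space: "complex_hilbert_space (energy_space c)"
  by (intro complex_hilbert_space.intro complex_hilbert_space_axioms.intro module_energy_space
      mcomplete_energy_space E.inner_add_right E.inner_smult_right E.inner_commute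
      E.inner_nonneg E.inner_definite)

lemma rkhs_energy_space: "rkhs (energy_space c) (normalized_rep ref)"
proof (intro rkhs.intro rkhs_axioms.intro complex_hilbert_space_energy_space)
  show "inj_on (normalized_rep ref) (carrier (energy_space c))"
  proof (rule inj_onI)
    fix U W
    assume "U \<in> carrier (energy_space c)" "W \<in> carrier (energy_space c)"
      and eq: "normalized_rep ref U = normalized_rep ref W"
    then obtain u w where uw: "u \<in> dom_energy c" "U = energy_class u"
        "w \<in> dom_energy c" "W = energy_class w"
      by (auto simp: carrier_energy_space)
    then have "u x - u ref = w x - w ref" for x
      using fun_cong[OF eq, of x] by (simp add: normalized_rep_class)
    then have "\<forall>x. u x = w x + (u ref - w ref)"
      by (simp add: algebra_simps)
    then show "U = W"
      using uw energy_class_eq_iff by blast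
  qed
next
  fix U W x assume "U \<in> carrier (energy_space c)" "W \<in> carrier (energy_space c)"
  then show "normalized_rep ref (U \<oplus>\<^bsub>energy_space c\<^esub> W) x = normalized_rep ref U x + normalized_rep ref W x"
    by (auto simp: carrier_energy_space add_energy_class normalized_rep_class dom_energy_add)
next
  fix U a x assume "U \<in> carrier (energy_space c)"
  then show "normalized_rep ref (a \<odot>\<^bsub>energy_space c\<^esub> U) x = a * normalized_rep ref U x"
    by (auto simp: carrier_energy_space smult_energy_class normalized_rep_class dom_energy_smult
        algebra_simps)
next
  fix x
  obtain B where "\<And>u. u \<in> dom_energy c \<Longrightarrow> cmod (u x - u ref) \<le> B * sqrt (Re (energy c u u))"
    using pointwise_bound by blast
  then show "\<exists>B. \<forall>U\<in>carrier (energy_space c).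
      cmod (normalized_rep ref U x) \<le> B * hnorm (energy_space c) U"
    by (auto simp: carrier_energy_space normalized_rep_class hnorm_energy_class)
qed

section \<open>Dipoles\<close>

text \<open>The increment \<open>u x - u ref\<close> is the same for all representatives
  \<open>u\<close> of a class and equals the value at \<open>x\<close> of the normalized one. The
  claim is thus Riesz for the bounded functional \<open>normalized_rep ref U x\<close> of
  \<open>U\<close>.\<close>

lemma ex1_dipole:
  "\<exists>!V. V \<in> carrier (energy_space c) \<and>
    (\<forall>U\<in>carrier (energy_space c). \<forall>u\<in>U. cinner (energy_space c) V U = u x - u ref)"
proof -
  interpret rkhs "energy_space c" "normalized_rep ref"
    by (rule rkhs_energy_space)
  obtain B where B: "\<And>U. U \<in> carrier (energy_space c) \<Longrightarrow>
      cmod (normalized_rep ref U x) \<le> B * hnorm (energy_space c) U"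
    using ev_bounded by blast
  have "(\<forall>u\<in>U. cinner (energy_space c) V U = u x - u ref)
      \<longleftrightarrow> cinner (energy_space c) V U = normalized_rep ref U x"
    if U: "U \<in> carrier (energy_space c)" for U V
  proof -
    \<comment> \<open>A class is nonempty, so the quantifier over its representatives is not
      vacuous.\<close>
    obtain w where "w \<in> U"
      using U energy_class_self by (auto simp: carrier_energy_space)
    then show ?thesis
      using normalized_rep_eq[OF U] by metis
  qed
  moreover have "\<exists>!V. V \<in> carrier (energy_space c) \<and>
      (\<forall>U\<in>carrier (energy_space c). cinner (energy_space c) V U = normalized_rep ref U x)"
    by (rule riesz[where B = B]) (simp_all add: ev_add ev_smult B)
  ultimately show ?thesis
    by (simp cong: conj_cong)
qed

lemma dipole_mem: "dipole c ref x \<in> carrier (energy_space c)"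
  and cinner_dipole: "U \<in> carrier (energy_space c) \<Longrightarrow> u \<in> U \<Longrightarrow>
    cinner (energy_space c) (dipole c ref x) U = u x - u ref"
  using theI'[OF ex1_dipole[of x ref]] by (simp_all add: dipole_def)

lemma reproducing_kernel_dipole:
  "reproducing_kernel (energy_space c) (normalized_rep ref) (dipole c ref)"
  unfolding reproducing_kernel_def
proof (intro conjI allI ballI rkhs_energy_space)
  show "range (dipole c ref) \<subseteq> carrier (energy_space c)"
    using dipole_mem by blast
  fix x U
  assume U: "U \<in> carrier (energy_space c)"
  then obtain u where "u \<in> U"
    using energy_class_self by (auto simp: carrier_energy_space)
  then show "cinner (energy_space c) (dipole c ref x) U = normalized_rep ref U x"
    using U by (simp add: cinner_dipole normalized_rep_eq)
qed

text \<open>Conductances are real, so the complex conjugate of \<open>v\<^sub>x\<close> also represents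
  \<open>u \<mapsto> u x - u ref\<close>.\<close>

lemma cnj_normalized_dipole:
  "cnj (normalized_rep ref (dipole c ref x) y) = normalized_rep ref (dipole c ref x) y"
proof -
  obtain d where d: "d \<in> dom_energy c" "dipole c ref x = energy_class d"
    using dipole_mem[of ref x] by (auto simp: carrier_energy_space)
  note d' = dom_energy_cnj[OF d(1)]
  have "cinner (energy_space c) (energy_class (\<lambda>x. cnj (d x))) U = u x - u ref"
    if U: "U \<in> carrier (energy_space c)" and u: "u \<in> U" for U u
  proof -
    obtain w where w: "w \<in> dom_energy c" "U = energy_class w"
      using U by (auto simp: carrier_energy_space)
    note w' = dom_energy_cnj[OF w(1)]
    \<comment> \<open>The dipole is tested against the conjugate of \<open>w\<close>;
      \<open>energy_cnj\<close> then transfers the conjugation to \<open>d\<close>, and the outer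
      conjugation restores \<open>w x - w ref\<close>.\<close>
    have "energy c d (\<lambda>x. cnj (w x)) = cnj (w x) - cnj (w ref)"
      using cinner_dipole[OF energy_class_mem[OF w'] energy_class_self[OF w'], of ref x] d w'
      by (simp add: cinner_energy_space)
    then have "cinner (energy_space c) (energy_class (\<lambda>x. cnj (d x))) U = w x - w ref"
      using d' w by (simp add: cinner_energy_space energy_cnj)
    also have "\<dots> = u x - u ref"
      using w u by (auto simp: const_rel_iff)
    finally show ?thesis .
  qed
  then have "dipole c ref x = energy_class (\<lambda>x. cnj (d x))"
    unfolding dipole_def by (intro the1_equality[OF ex1_dipole] conjI ballI energy_class_mem d')
  then have "normalized_rep ref (energy_class (\<lambda>x. cnj (d x))) = normalized_rep ref (energy_class d)"
    by (simp only: d(2))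
  from fun_cong[OF this, of y] have "cnj (d y) - cnj (d ref) = d y - d ref"
    by (simp only: normalized_rep_class[OF d(1)] normalized_rep_class[OF d'])
  then show ?thesis
    by (simp only: d(2) normalized_rep_class[OF d(1)] complex_cnj_diff)
qed

lemma closure_hspan_dipoles:
  "htopology (energy_space c) closure_of hspan (energy_space c) (range (dipole c ref))
    = carrier (energy_space c)"
proof -
  interpret rkhs "energy_space c" "normalized_rep ref"
    by (rule rkhs_energy_space)
  show ?thesis
  proof (rule closure_hspan)
    show "range (dipole c ref) \<subseteq> carrier (energy_space c)"
      using dipole_mem by blast
    fix U
    assume U: "U \<in> carrier (energy_space c)"
      and orth: "\<forall>V\<in>range (dipole c ref). cinner (energy_space c) U V = 0"
    have "normalized_rep ref U x = 0" for x
    proof -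
      have "cinner (energy_space c) (dipole c ref x) U = 0"
        using orth U dipole_mem E.inner_commute[of U "dipole c ref x"] by simp
      then show ?thesis
        using reproducing_kernel_dipole[of ref] U by (simp add: reproducing_kernel_def)
    qed
    then have "normalized_rep ref U = normalized_rep ref \<zero>\<^bsub>energy_space c\<^esub>"
      using dom_energy_const by (simp add: zero_energy_space normalized_rep_class fun_eq_iff)
    then show "U = \<zero>\<^bsub>energy_space c\<^esub>"
      using ev_inj U by (simp add: inj_on_eq_iff)
  qed
qed

end

theorem corollary2p7:
  fixes c :: "'v \<Rightarrow> 'v \<Rightarrow> real" and ref :: 'v
  assumes "resistance_network c"
  defines "H \<equiv> energy_space c"
    and "v \<equiv> dipole c ref"
  shows "(\<forall>x. \<exists>!V. V \<in> carrier H \<and> (\<forall>U\<in>carrier H. \<forall>u\<in>U. cinner H V U = u x - u ref))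
    \<and> reproducing_kernel H (normalized_rep ref) v
    \<and> (\<forall>x y. cinner H (v x) (v y) = normalized_rep ref (v x) y
         \<and> normalized_rep ref (v x) y = cnj (normalized_rep ref (v y) x))
    \<and> htopology H closure_of hspan H (range v) = carrier H"
proof -
  interpret resistance_network c
    by (rule assms(1))
  interpret complex_inner_space H
    unfolding H_def by (rule complex_inner_space_energy_space)
  have mem: "v x \<in> carrier H" for x
    unfolding H_def v_def by (rule dipole_mem)
  have kernel: "cinner H (v x) (v y) = normalized_rep ref (v y) x" for x y
    using reproducing_kernel_dipole[of ref] mem
    by (simp add: reproducing_kernel_def H_def v_def)
  have sym: "normalized_rep ref (v x) y = cnj (normalized_rep ref (v y) x)" for x y
    using inner_commute[OF mem mem, of x y] by (simp add: kernel)
  \<comment> \<open>Real-valuedness of \<open>v y\<close> removes the conjugation that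
    \<open>sym\<close> leaves between the two orders of the arguments.\<close>
  have "cinner H (v x) (v y) = normalized_rep ref (v x) y" for x y
    using kernel[of x y] sym[of x y] cnj_normalized_dipole[of ref y x] by (simp add: v_def)
  with sym show ?thesis
    unfolding H_def v_def
    by (intro conjI allI ex1_dipole reproducing_kernel_dipole closure_hspan_dipoles)
qed

end
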